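(* The dual group of $\ell_1$, i.e. the additive group of $\ell_\infty=(\ell_1)^\ast$ equipped with the topology $\tau_k(\ell_1)$ of uniform convergence on compact subsets of $\ell_1$, is not unitarily representable.
   Context: A topological group is called unitarily representable if it is topologically isomorphic to a subgroup of the unitary group $\mathcal{U}(\mathbb{H})$ of some Hilbert space $\mathbb{H}$ (of arbitrary dimension), where $\mathcal{U}(\mathbb{H})$ carries the strong operator topology. Elements of $\ell_\infty$ act on $\ell_1$ by $\langle x,y\rangle=\sum_n x_ny_n$; compact subsets of $\ell_1$ are norm compact. *)

theory Defs
  imports "HOL-Analysis.Analysis" "HOL-Algebra.Group"
begin

section \<open>Complex Hilbert spaces\<close>

text \<open>
  The distribution has only real inner products. A complex Hilbert space is taken to be a Banach
  space with a complex scalar multiplication and a positive definite sesquilinear form, linear in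
  its second argument, inducing the norm. There is no restriction on the dimension, and positive
  definiteness follows from the norm axioms.
\<close>

class complex_hilbert_space = banach +
  fixes scaleC :: "complex \<Rightarrow> 'a \<Rightarrow> 'a" (infixr "*\<^sub>C" 75)
    and cinner :: "'a \<Rightarrow> 'a \<Rightarrow> complex"
  assumes scaleC_add_right: "c *\<^sub>C (x + y) = c *\<^sub>C x + c *\<^sub>C y"
    and scaleC_add_left: "(c + d) *\<^sub>C x = c *\<^sub>C x + d *\<^sub>C x"
    and scaleC_scaleC: "c *\<^sub>C d *\<^sub>C x = (c * d) *\<^sub>C x"
    and scaleC_one: "1 *\<^sub>C x = x"
    and scaleR_scaleC: "scaleR r x = of_real r *\<^sub>C x"
    and cinner_commute: "cinner x y = cnj (cinner y x)"
    and cinner_add_right: "cinner x (y + z) = cinner x y + cinner x z"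
    and cinner_scaleC_right: "cinner x (c *\<^sub>C y) = c * cinner x y"
    and cinner_ge_zero: "0 \<le> Re (cinner x x)"
    and norm_eq_sqrt_cinner: "norm x = sqrt (Re (cinner x x))"

instantiation complex :: complex_hilbert_space
begin

definition scaleC_complex :: "complex \<Rightarrow> complex \<Rightarrow> complex"
  where "scaleC_complex c x = c * x"

definition cinner_complex :: "complex \<Rightarrow> complex \<Rightarrow> complex"
  where "cinner_complex x y = cnj x * y"

instance
  by standard
    (auto simp: scaleC_complex_def cinner_complex_def algebra_simps scaleR_conv_of_real
      cmod_def power2_eq_square)

end


section \<open>Unitary representability\<close>

definition unitary_operators :: "('h::complex_hilbert_space \<Rightarrow> 'h) set"
  where "unitary_operators =
    {U. (\<forall>x y. U (x + y) = U x + U y) \<and> (\<forall>c x. U (c *\<^sub>C x) = c *\<^sub>C U x)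
      \<and> surj U \<and> (\<forall>x y. cinner (U x) (U y) = cinner x y)}"

definition unitary_group :: "('h::complex_hilbert_space \<Rightarrow> 'h) monoid"
  where "unitary_group = \<lparr>carrier = unitary_operators, mult = (\<circ>), one = id\<rparr>"

text \<open>
  The strong operator topology is the topology of pointwise convergence in norm, that is, the one
  inherited from the product of copies of the normed space indexed by its own points.
\<close>

definition strong_operator_topology :: "('h::complex_hilbert_space \<Rightarrow> 'h) topology"
  where "strong_operator_topology =
    subtopology (product_topology (\<lambda>_. euclidean) UNIV) unitary_operators"

definition topological_group :: "('a, 'm) monoid_scheme \<Rightarrow> 'a topology \<Rightarrow> bool"
  where "topological_group G T \<longleftrightarrow>
    group G \<and> topspace T = carrier G \<and>
    continuous_map (prod_topology T T) T (\<lambda>(x, y). x \<otimes>\<^bsub>G\<^esub> y) \<and>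
    continuous_map T T (m_inv G)"

definition topological_group_iso ::
  "('a, 'm) monoid_scheme \<Rightarrow> 'a topology \<Rightarrow> ('b, 'n) monoid_scheme \<Rightarrow> 'b topology \<Rightarrow> ('a \<Rightarrow> 'b) set"
  where "topological_group_iso G S H T = {f \<in> iso G H. homeomorphic_map S T f}"

text \<open>
  HOL cannot quantify over types inside a formula, so the type of the Hilbert space is a parameter:
  a topological group is unitarily representable iff this predicate holds at some type, and it is
  not unitarily representable iff the predicate fails at every type. The predicate is meant for
  topological groups, which are not required to be Hausdorff.
\<close>

definition unitarily_representable_on ::
  "'h::complex_hilbert_space itself \<Rightarrow> ('a, 'm) monoid_scheme \<Rightarrow> 'a topology \<Rightarrow> bool"
  where "unitarily_representable_on TYPE('h) G T \<longleftrightarrow>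
    (\<exists>(S :: ('h \<Rightarrow> 'h) set) f. subgroup S unitary_group \<and>
      f \<in> topological_group_iso G T
            (unitary_group\<lparr>carrier := S\<rparr>) (subtopology strong_operator_topology S))"

lemma unitary_operators_inj:
  fixes U :: "'h::complex_hilbert_space \<Rightarrow> 'h"
  assumes "U \<in> unitary_operators"
  shows "inj U"
proof (rule injI)
  fix x y assume eq: "U x = U y"
  have "U x = U (x - y) + U y"
    using assms by (metis (mono_tags, lifting) diff_add_cancel mem_Collect_eq unitary_operators_def)
  with eq have "U (x - y) = 0" by simp
  moreover have "norm (U (x - y)) = norm (x - y)"
    using assms by (simp add: unitary_operators_def norm_eq_sqrt_cinner)
  ultimately show "x = y" by simp
qed

lemma group_unitary_group: "group (unitary_group :: ('h::complex_hilbert_space \<Rightarrow> 'h) monoid)"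
proof (rule groupI)
  fix U :: "'h \<Rightarrow> 'h" assume "U \<in> carrier unitary_group"
  then have U: "U \<in> unitary_operators" by (simp add: unitary_group_def)
  define V where "V = inv_into UNIV U"
  have UV: "U (V x) = x" for x
    using U by (simp add: V_def unitary_operators_def surj_f_inv_f)
  have VU: "V (U x) = x" for x
    using unitary_operators_inj[OF U] by (simp add: V_def)
  have "V (x + y) = V x + V y" for x y
  proof -
    have "U (V x + V y) = x + y" using U UV by (simp add: unitary_operators_def)
    then show ?thesis by (metis VU)
  qed
  moreover have "V (c *\<^sub>C x) = c *\<^sub>C V x" for c x
  proof -
    have "U (c *\<^sub>C V x) = c *\<^sub>C x" using U UV by (simp add: unitary_operators_def)
    then show ?thesis by (metis VU)
  qed
  moreover have "cinner (V x) (V y) = cinner x y" for x y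
  proof -
    have "cinner (U (V x)) (U (V y)) = cinner (V x) (V y)"
      using U unfolding unitary_operators_def by blast
    then show ?thesis by (simp add: UV)
  qed
  moreover have "surj V" by (metis VU surjI)
  ultimately have "V \<in> unitary_operators" by (simp add: unitary_operators_def)
  then show "\<exists>V\<in>carrier unitary_group. V \<otimes>\<^bsub>unitary_group\<^esub> U = \<one>\<^bsub>unitary_group\<^esub>"
    using VU by (auto simp: unitary_group_def fun_eq_iff intro!: bexI[of _ V])
next
  fix U V :: "'h \<Rightarrow> 'h"
  assume "U \<in> carrier unitary_group" "V \<in> carrier unitary_group"
  then show "U \<otimes>\<^bsub>unitary_group\<^esub> V \<in> carrier unitary_group"
    using comp_surj[of V U] by (simp add: unitary_group_def unitary_operators_def)
qed (auto simp: unitary_group_def unitary_operators_def o_assoc)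


section \<open>The group \<open>\<ell>\<^sub>\<infinity>\<close> with the topology \<open>\<tau>\<^sub>k(\<ell>\<^sub>1)\<close>\<close>

text \<open>
  Sequences are real. The sums below converge absolutely wherever they matter; \<open>infsum\<close> is used
  rather than \<open>suminf\<close> because it is 0 on families that are not summable, which makes \<open>ell1_dist\<close>
  nonnegative on all of its type, as the locale for metric spaces demands.
\<close>

definition ell1 :: "(nat \<Rightarrow> real) set"
  where "ell1 = {x. (\<lambda>n. \<bar>x n\<bar>) summable_on UNIV}"

definition ell1_dist :: "(nat \<Rightarrow> real) \<Rightarrow> (nat \<Rightarrow> real) \<Rightarrow> real"
  where "ell1_dist x y = (\<Sum>\<^sub>\<infinity>n. \<bar>x n - y n\<bar>)"

definition ell_infty :: "(nat \<Rightarrow> real) set"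
  where "ell_infty = {y. bounded (range y)}"

definition ell_infty_group :: "(nat \<Rightarrow> real) monoid"
  where "ell_infty_group = \<lparr>carrier = ell_infty, mult = (\<lambda>y z n. y n + z n), one = (\<lambda>n. 0)\<rparr>"

definition pairing :: "(nat \<Rightarrow> real) \<Rightarrow> (nat \<Rightarrow> real) \<Rightarrow> real"
  where "pairing x y = (\<Sum>\<^sub>\<infinity>n. x n * y n)"

lemma summable_ell1_diff:
  assumes "x \<in> ell1" "y \<in> ell1"
  shows "(\<lambda>n. \<bar>x n - y n\<bar>) summable_on UNIV"
proof (rule summable_on_comparison_test)
  show "(\<lambda>n. \<bar>x n\<bar> + \<bar>y n\<bar>) summable_on UNIV"
    using assms by (simp add: ell1_def summable_on_add)
qed auto

interpretation ell1: Metric_space ell1 ell1_dist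
proof
  fix x y
  show "0 \<le> ell1_dist x y"
    by (simp add: ell1_dist_def infsum_nonneg)
  show "ell1_dist x y = ell1_dist y x"
    by (simp add: ell1_dist_def abs_minus_commute)
  assume *: "x \<in> ell1" "y \<in> ell1"
  show "ell1_dist x y = 0 \<longleftrightarrow> x = y"
  proof
    assume "ell1_dist x y = 0"
    then have "\<bar>x n - y n\<bar> = 0" for n
      using nonneg_infsum_le_0D[OF _ summable_ell1_diff[OF *]] by (simp add: ell1_dist_def)
    then show "x = y" by auto
  qed (simp add: ell1_dist_def)
next
  fix x y z assume *: "x \<in> ell1" "y \<in> ell1" "z \<in> ell1"
  have "ell1_dist x z \<le> (\<Sum>\<^sub>\<infinity>n. \<bar>x n - y n\<bar> + \<bar>y n - z n\<bar>)"
    unfolding ell1_dist_def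
    by (intro infsum_mono summable_on_add summable_ell1_diff *) auto
  also have "\<dots> = ell1_dist x y + ell1_dist y z"
    unfolding ell1_dist_def by (intro infsum_add summable_ell1_diff *)
  finally show "ell1_dist x z \<le> ell1_dist x y + ell1_dist y z" .
qed

text \<open>
  Uniform convergence on compact subsets of \<open>\<ell>\<^sub>1\<close>: the sets \<open>tau_k_nbhd y K e\<close>, with \<open>K\<close> norm compact
  and \<open>e > 0\<close>, form a neighbourhood base at \<open>y\<close>.
\<close>

definition tau_k_nbhd :: "(nat \<Rightarrow> real) \<Rightarrow> (nat \<Rightarrow> real) set \<Rightarrow> real \<Rightarrow> (nat \<Rightarrow> real) set"
  where "tau_k_nbhd y K e = {z \<in> ell_infty. \<forall>x\<in>K. \<bar>pairing x z - pairing x y\<bar> < e}"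

definition tau_k_open :: "(nat \<Rightarrow> real) set \<Rightarrow> bool"
  where "tau_k_open U \<longleftrightarrow> U \<subseteq> ell_infty \<and>
    (\<forall>y\<in>U. \<exists>K e. compactin ell1.mtopology K \<and> e > 0 \<and> tau_k_nbhd y K e \<subseteq> U)"

definition tau_k :: "(nat \<Rightarrow> real) topology"
  where "tau_k = topology tau_k_open"

lemma istopology_tau_k_open: "istopology tau_k_open"
  unfolding istopology_def
proof (intro conjI allI impI)
  fix U V assume U: "tau_k_open U" and V: "tau_k_open V"
  show "tau_k_open (U \<inter> V)"
    unfolding tau_k_open_def
  proof (intro conjI ballI)
    show "U \<inter> V \<subseteq> ell_infty" using U by (auto simp: tau_k_open_def)
    fix y assume "y \<in> U \<inter> V"
    then obtain K d L e where "compactin ell1.mtopology K" "d > 0" "tau_k_nbhd y K d \<subseteq> U"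
      and "compactin ell1.mtopology L" "e > 0" "tau_k_nbhd y L e \<subseteq> V"
      using U V unfolding tau_k_open_def by (metis IntE)
    then have "compactin ell1.mtopology (K \<union> L) \<and> min d e > 0 \<and>
        tau_k_nbhd y (K \<union> L) (min d e) \<subseteq> U \<inter> V"
      by (auto simp: tau_k_nbhd_def compactin_Un)
    then show "\<exists>K e. compactin ell1.mtopology K \<and> e > 0 \<and> tau_k_nbhd y K e \<subseteq> U \<inter> V" by blast
  qed
next
  fix \<U> assume "\<forall>U\<in>\<U>. tau_k_open U"
  then show "tau_k_open (\<Union>\<U>)"
    unfolding tau_k_open_def by (meson Sup_le_iff UnionE Union_upper subset_trans)
qed

lemma openin_tau_k: "openin tau_k U \<longleftrightarrow> tau_k_open U"
  by (simp add: tau_k_def istopology_tau_k_open topology_inverse')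

lemma topspace_tau_k: "topspace tau_k = ell_infty"
proof
  show "topspace tau_k \<subseteq> ell_infty"
    using openin_topspace[of tau_k] unfolding openin_tau_k tau_k_open_def by blast
  have "tau_k_open ell_infty"
    by (auto simp: tau_k_open_def tau_k_nbhd_def intro!: exI[of _ "{}"] exI[of _ "1::real"])
  then show "ell_infty \<subseteq> topspace tau_k"
    by (simp add: openin_subset openin_tau_k)
qed

lemma summable_pairing:
  assumes "x \<in> ell1" "y \<in> ell_infty"
  shows "(\<lambda>n. x n * y n) summable_on UNIV"
proof -
  obtain B where B: "\<And>n. \<bar>y n\<bar> \<le> B"
    using assms(2) by (auto simp: ell_infty_def bounded_iff)
  have "(\<lambda>n. norm (x n * y n)) summable_on UNIV"
  proof (rule summable_on_comparison_test)
    show "(\<lambda>n. \<bar>x n\<bar> * B) summable_on UNIV"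
      using assms(1) by (simp add: ell1_def summable_on_cmult_left)
    show "norm (x n * y n) \<le> \<bar>x n\<bar> * B" for n
      using B by (simp add: abs_mult mult_left_mono)
  qed auto
  then show ?thesis by (rule abs_summable_summable)
qed

lemma ell_infty_add: "y \<in> ell_infty \<Longrightarrow> z \<in> ell_infty \<Longrightarrow> (\<lambda>n. y n + z n) \<in> ell_infty"
  unfolding ell_infty_def using bounded_plus_comp[of y UNIV z] by simp

lemma ell_infty_minus: "y \<in> ell_infty \<Longrightarrow> (\<lambda>n. - y n) \<in> ell_infty"
  unfolding ell_infty_def by (simp add: bounded_iff)

lemma pairing_add:
  assumes "x \<in> ell1" "y \<in> ell_infty" "z \<in> ell_infty"
  shows "pairing x (\<lambda>n. y n + z n) = pairing x y + pairing x z"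
  using assms by (simp add: pairing_def distrib_left infsum_add summable_pairing)

lemma pairing_minus: "pairing x (\<lambda>n. - y n) = - pairing x y"
  by (simp add: pairing_def infsum_uminus)

lemma tau_k_nbhd_interior:
  assumes "compactin ell1.mtopology K" "y \<in> ell_infty" "e > 0"
  obtains V where "openin tau_k V" "y \<in> V" "V \<subseteq> tau_k_nbhd y K e"
proof
  define V where
    "V = {z \<in> ell_infty. \<exists>d<e. \<forall>x\<in>K. \<bar>pairing x z - pairing x y\<bar> \<le> d}"
  show "y \<in> V" using assms by (auto simp: V_def)
  show "V \<subseteq> tau_k_nbhd y K e" by (force simp: V_def tau_k_nbhd_def)
  show "openin tau_k V"
    unfolding openin_tau_k tau_k_open_def
  proof (intro conjI ballI)
    show "V \<subseteq> ell_infty" by (auto simp: V_def)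
    fix z assume "z \<in> V"
    then obtain d where d: "d < e" "\<And>x. x \<in> K \<Longrightarrow> \<bar>pairing x z - pairing x y\<bar> \<le> d"
      by (auto simp: V_def)
    have "w \<in> V" if w: "w \<in> tau_k_nbhd z K ((e - d) / 2)" for w
    proof -
      have "\<bar>pairing x w - pairing x y\<bar> \<le> d + (e - d) / 2" if "x \<in> K" for x
      proof -
        have "\<bar>pairing x w - pairing x z\<bar> < (e - d) / 2"
          using w that by (simp add: tau_k_nbhd_def)
        then show ?thesis using d(2)[OF that] by linarith
      qed
      moreover have "d + (e - d) / 2 < e" using d(1) by (simp add: field_simps)
      ultimately show ?thesis using w unfolding V_def tau_k_nbhd_def by blast
    qed
    then show "\<exists>K e. compactin ell1.mtopology K \<and> e > 0 \<and> tau_k_nbhd z K e \<subseteq> V"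
      using assms(1) d(1) by (intro exI[of _ K] exI[of _ "(e - d) / 2"]) auto
  qed
qed

lemma group_ell_infty_group: "group ell_infty_group"
proof (rule groupI)
  fix y assume "y \<in> carrier ell_infty_group"
  then show "\<exists>z\<in>carrier ell_infty_group. z \<otimes>\<^bsub>ell_infty_group\<^esub> y = \<one>\<^bsub>ell_infty_group\<^esub>"
    by (auto simp: ell_infty_group_def ell_infty_minus intro!: bexI[of _ "\<lambda>n. - y n"])
next
  show "\<one>\<^bsub>ell_infty_group\<^esub> \<in> carrier ell_infty_group"
    by (simp add: ell_infty_group_def ell_infty_def)
qed (auto simp: ell_infty_group_def ell_infty_add algebra_simps)

lemma inv_ell_infty_group:
  assumes "y \<in> ell_infty"
  shows "m_inv ell_infty_group y = (\<lambda>n. - y n)"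
  by (rule group.inv_equality[OF group_ell_infty_group])
    (use assms in \<open>auto simp: ell_infty_group_def ell_infty_minus\<close>)

lemma topological_group_ell_infty: "topological_group ell_infty_group tau_k"
  unfolding topological_group_def
proof (intro conjI group_ell_infty_group)
  show "topspace tau_k = carrier ell_infty_group"
    by (simp add: topspace_tau_k ell_infty_group_def)
  show "continuous_map (prod_topology tau_k tau_k) tau_k (\<lambda>(x, y). x \<otimes>\<^bsub>ell_infty_group\<^esub> y)"
    unfolding continuous_map_def
  proof (intro conjI allI impI)
    show "(\<lambda>(x, y). x \<otimes>\<^bsub>ell_infty_group\<^esub> y)
        \<in> topspace (prod_topology tau_k tau_k) \<rightarrow> topspace tau_k"
      by (auto simp: topspace_tau_k ell_infty_group_def ell_infty_add)
    fix U assume U: "openin tau_k U"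
    show "openin (prod_topology tau_k tau_k)
        {p \<in> topspace (prod_topology tau_k tau_k). (case p of (x, y) \<Rightarrow> x \<otimes>\<^bsub>ell_infty_group\<^esub> y) \<in> U}"
      unfolding openin_prod_topology_alt
    proof (intro allI impI)
      fix y z
      assume "(y, z) \<in> {p \<in> topspace (prod_topology tau_k tau_k).
        (case p of (x, y) \<Rightarrow> x \<otimes>\<^bsub>ell_infty_group\<^esub> y) \<in> U}"
      then have yz: "y \<in> ell_infty" "z \<in> ell_infty" "(\<lambda>n. y n + z n) \<in> U"
        by (auto simp: topspace_tau_k ell_infty_group_def)
      then obtain K e where K: "compactin ell1.mtopology K" "e > 0"
          "tau_k_nbhd (\<lambda>n. y n + z n) K e \<subseteq> U"
        using U unfolding openin_tau_k tau_k_open_def by blast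
      obtain V where V: "openin tau_k V" "y \<in> V" "V \<subseteq> tau_k_nbhd y K (e / 2)"
        using tau_k_nbhd_interior[OF K(1) yz(1), of "e / 2"] K(2) by auto
      obtain W where W: "openin tau_k W" "z \<in> W" "W \<subseteq> tau_k_nbhd z K (e / 2)"
        using tau_k_nbhd_interior[OF K(1) yz(2), of "e / 2"] K(2) by auto
      have Kl: "x \<in> ell1" if "x \<in> K" for x
        using K(1) that compactin_subset_topspace by fastforce
      have "(\<lambda>n. v n + w n) \<in> U \<and> v \<in> ell_infty \<and> w \<in> ell_infty" if "v \<in> V" "w \<in> W" for v w
      proof -
        have vw: "v \<in> tau_k_nbhd y K (e / 2)" "w \<in> tau_k_nbhd z K (e / 2)"
          using that V(3) W(3) by auto
        then have l: "v \<in> ell_infty" "w \<in> ell_infty" by (auto simp: tau_k_nbhd_def)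
        have "\<bar>pairing x (\<lambda>n. v n + w n) - pairing x (\<lambda>n. y n + z n)\<bar> < e" if "x \<in> K" for x
        proof -
          have "\<bar>pairing x v - pairing x y\<bar> < e / 2" "\<bar>pairing x w - pairing x z\<bar> < e / 2"
            using vw that by (auto simp: tau_k_nbhd_def)
          then show ?thesis
            unfolding pairing_add[OF Kl[OF that] l] pairing_add[OF Kl[OF that] yz(1,2)]
            by linarith
        qed
        then show ?thesis
          using K(3) l by (auto simp: tau_k_nbhd_def ell_infty_add)
      qed
      then show "\<exists>V W. openin tau_k V \<and> openin tau_k W \<and> y \<in> V \<and> z \<in> W \<and> V \<times> W \<subseteq>
          {p \<in> topspace (prod_topology tau_k tau_k).
            (case p of (x, y) \<Rightarrow> x \<otimes>\<^bsub>ell_infty_group\<^esub> y) \<in> U}"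
        using V(1,2) W(1,2)
        by (intro exI[of _ V] exI[of _ W]) (auto simp: topspace_tau_k ell_infty_group_def)
    qed
  qed
  show "continuous_map tau_k tau_k (m_inv ell_infty_group)"
    unfolding continuous_map_def
  proof (intro conjI allI impI)
    show "m_inv ell_infty_group \<in> topspace tau_k \<rightarrow> topspace tau_k"
      by (auto simp: topspace_tau_k inv_ell_infty_group ell_infty_minus)
    fix U assume U: "openin tau_k U"
    show "openin tau_k {y \<in> topspace tau_k. m_inv ell_infty_group y \<in> U}"
      unfolding openin_tau_k tau_k_open_def
    proof (intro conjI ballI)
      fix y assume "y \<in> {y \<in> topspace tau_k. m_inv ell_infty_group y \<in> U}"
      then have y: "y \<in> ell_infty" "(\<lambda>n. - y n) \<in> U"
        by (auto simp: topspace_tau_k inv_ell_infty_group)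
      then obtain K e where K: "compactin ell1.mtopology K" "e > 0"
          "tau_k_nbhd (\<lambda>n. - y n) K e \<subseteq> U"
        using U unfolding openin_tau_k tau_k_open_def by blast
      have "(\<lambda>n. - z n) \<in> U \<and> z \<in> ell_infty" if "z \<in> tau_k_nbhd y K e" for z
      proof -
        have "(\<lambda>n. - z n) \<in> tau_k_nbhd (\<lambda>n. - y n) K e"
          using that by (auto simp: tau_k_nbhd_def pairing_minus ell_infty_minus abs_minus_commute)
        then show ?thesis using K(3) that by (auto simp: tau_k_nbhd_def)
      qed
      then show "\<exists>K e. compactin ell1.mtopology K \<and> e > 0 \<and>
          tau_k_nbhd y K e \<subseteq> {y \<in> topspace tau_k. m_inv ell_infty_group y \<in> U}"
        using K(1,2)
        by (intro exI[of _ K] exI[of _ e]) (auto simp: topspace_tau_k inv_ell_infty_group)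
    qed (auto simp: topspace_tau_k)
  qed
qed

end

theory Submission
  imports Defs "HOL-Library.Discrete_Functions"
begin

text \<open>
  The obstruction is that \<open>\<ell>\<^sub>\<infinity>\<close> contains cubes: all the \<open>0\<close>-\<open>1\<close> sequences supported on
  \<open>{N..<2N}\<close> are uniformly small on a compact subset of \<open>\<ell>\<^sub>1\<close> once \<open>N\<close> is large, because the
  tails of a compact set are uniformly small (lemma \<open>compact_pairing_tail_small\<close>). In a Hilbert
  space, a family of commuting isometries whose products over all subsets of the family nearly fix
  a vector cannot consist of \<open>N\<close> isometries that each move it far: the squared displacements,
  taken at a nearby vector, have a sum bounded independently of \<open>N\<close>.

  In detail, let \<open>f\<close> be a topological isomorphism onto a group of unitary operators, let \<open>e\<^sub>n\<close> be the
  \<open>n\<close>-th unit sequence, and put \<open>a\<^sub>n = \<lfloor>\<surd>n\<rfloor>\<close>. The set \<open>K\<close> consisting of \<open>0\<close> and the sequences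
  \<open>e\<^sub>n / a\<^sub>n\<close> is compact in \<open>\<ell>\<^sub>1\<close>, and none of the sequences \<open>a\<^sub>n e\<^sub>n\<close> with \<open>n \<ge> 1\<close> lies in the
  neighbourhood of \<open>0\<close> where \<open>K\<close> pairs to less than \<open>1\<close>. As \<open>f\<close> is open, there are a finite set
  \<open>F\<close> of vectors and \<open>e > 0\<close> such that each \<open>f (a\<^sub>n e\<^sub>n)\<close> with \<open>n \<ge> 1\<close> moves some vector of \<open>F\<close>
  by at least \<open>e\<close>. As \<open>f\<close> is continuous, for every \<open>d > 0\<close> and all large \<open>N\<close> the images of the
  \<open>0\<close>-\<open>1\<close> sequences supported on \<open>{N..<2N}\<close> move every vector of \<open>F\<close> by less than \<open>d\<close>.

  Lemma \<open>exists_slow_direction\<close> contradicts this. Let \<open>V\<^sub>i\<close> be the image of \<open>e\<^bsub>N+i\<^esub>\<close> and \<open>h\<close>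
  the image of a vector \<open>x\<close> under the product of the \<open>N\<close> averages \<open>(1 + V\<^sub>i) / 2\<close>. On the one hand
  \<open>h\<close> is an average of images of \<open>x\<close> under \<open>0\<close>-\<open>1\<close> sequences, so it is within \<open>d\<close> of \<open>x\<close>. On the other
  hand, by the parallelogram law each average loses a quarter of \<open>\<parallel>V\<^sub>i y - y\<parallel>\<^sup>2\<close> from the squared
  norm of its argument \<open>y\<close>, and \<open>h\<close> has hardly lost any. As the isometries commute, \<open>V\<^sub>i\<close> moves \<open>h\<close>
  no farther than \<open>y\<close>; hence the squares \<open>\<parallel>V\<^sub>i h - h\<parallel>\<^sup>2\<close> sum to \<open>O(d)\<close>, and for one of the
  \<open>N\<close> indices this square is \<open>O(d / N)\<close>. Taking the power \<open>a\<^bsub>N+i\<^esub> = O(\<surd>N)\<close> of \<open>V\<^sub>i\<close> turns a displacement \<open>O(\<surd>(d / N))\<close> of \<open>h\<close> into at most \<open>O(\<surd>d)\<close>, so the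
  displacement of \<open>x\<close> is at most \<open>2 d + O(\<surd>d)\<close>, which is below \<open>e\<close> for small \<open>d\<close>.
\<close>

section \<open>Commuting isometries of a Hilbert space\<close>

lemma parallelogram_law:
  fixes x y :: "'h::complex_hilbert_space"
  shows "(norm (x + y))\<^sup>2 + (norm (x - y))\<^sup>2 = 2 * (norm x)\<^sup>2 + 2 * (norm y)\<^sup>2"
proof -
  have sq: "(norm z)\<^sup>2 = Re (cinner z z)" for z :: 'h
    by (simp add: norm_eq_sqrt_cinner cinner_ge_zero)
  have add_left: "cinner (u + v) w = cinner u w + cinner v w" for u v w :: 'h
    by (metis cinner_add_right cinner_commute complex_cnj_add)
  have "cinner (- y) w = - cinner y w" for w
    using add_left[of y "- y" w] add_left[of 0 0 w] by (simp add: add_eq_0_iff)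
  moreover have "cinner w (- y) = - cinner w y" for w
    using cinner_add_right[of w y "- y"] cinner_add_right[of w 0 0] by (simp add: add_eq_0_iff)
  ultimately show ?thesis
    using add_left[of x "- y"] cinner_add_right[of _ x "- y"]
    by (simp add: sq add_left cinner_add_right)
qed

text \<open>
  The product of the averages \<open>(1 + V i) / 2\<close> for \<open>i < n\<close>, applied to \<open>x\<close>. Expanding the product
  gives the mean of the images of \<open>x\<close> under all \<open>2 ^ n\<close> products of distinct \<open>V i\<close>; these
  images form \<open>cube_orbit V n x\<close>.
\<close>

primrec half_step_product ::
  "(nat \<Rightarrow> 'h \<Rightarrow> 'h) \<Rightarrow> nat \<Rightarrow> 'h \<Rightarrow> 'h::complex_hilbert_space" where
  "half_step_product V 0 x = x"
| "half_step_product V (Suc n) x =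
    (1/2) *\<^sub>R (half_step_product V n x + V n (half_step_product V n x))"

primrec cube_orbit :: "(nat \<Rightarrow> 'h \<Rightarrow> 'h) \<Rightarrow> nat \<Rightarrow> 'h \<Rightarrow> 'h set" where
  "cube_orbit V 0 x = {x}"
| "cube_orbit V (Suc n) x = cube_orbit V n x \<union> V n ` cube_orbit V n x"

lemma half_step_product_in_convex_hull:
  assumes "\<And>i. linear (V i)"
  shows "half_step_product V n x \<in> convex hull (cube_orbit V n x)"
proof (induction n)
  case (Suc n)
  let ?h = "half_step_product V n x" and ?C = "convex hull (cube_orbit V (Suc n) x)"
  have "?h \<in> ?C"
    using Suc hull_mono[of "cube_orbit V n x" "cube_orbit V (Suc n) x" convex] by auto
  moreover have "V n ?h \<in> convex hull (V n ` cube_orbit V n x)"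
    using Suc convex_hull_linear_image[OF assms] by blast
  then have "V n ?h \<in> ?C"
    using hull_mono[of "V n ` cube_orbit V n x" "cube_orbit V (Suc n) x" convex] by auto
  ultimately have "(1/2) *\<^sub>R ?h + (1/2) *\<^sub>R V n ?h \<in> ?C"
    using convex_convex_hull by (intro convexD) auto
  then show ?case by (simp add: scaleR_add_right)
qed auto

text \<open>
  By the parallelogram law, averaging an isometry \<open>V n\<close> with the identity lowers \<open>\<parallel>h\<parallel>\<^sup>2\<close> by exactly a
  quarter of \<open>\<parallel>V n h - h\<parallel>\<^sup>2\<close>. Later averages commute with \<open>V n\<close> and do not increase norms, so they
  do not increase this displacement either, and the losses add up along the product.
\<close>

lemma sum_displacements_half_step_product:
  fixes V :: "nat \<Rightarrow> 'h \<Rightarrow> 'h::complex_hilbert_space"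
  assumes lin: "\<And>i. linear (V i)" and iso: "\<And>i x. norm (V i x) = norm x"
    and comm: "\<And>i j x. V i (V j x) = V j (V i x)"
  shows "(\<Sum>i<n. (norm (V i (half_step_product V n x) - half_step_product V n x))\<^sup>2)
    \<le> 4 * ((norm x)\<^sup>2 - (norm (half_step_product V n x))\<^sup>2)"
proof (induction n)
  case (Suc n)
  let ?h = "half_step_product V n x" and ?h' = "half_step_product V (Suc n) x"
  have move: "norm (V i ?h' - ?h') \<le> norm (V i ?h - ?h)" for i
  proof -
    have "V i ?h' - ?h' = (1/2) *\<^sub>R ((V i ?h - ?h) + V n (V i ?h - ?h))"
      using lin comm by (simp add: linear_add linear_diff linear_scale algebra_simps)
    then have "norm (V i ?h' - ?h') \<le> (1/2) * (norm (V i ?h - ?h) + norm (V n (V i ?h - ?h)))"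
      using norm_triangle_ineq by (metis abs_of_nonneg mult_left_mono norm_scaleR
        zero_le_divide_1_iff zero_le_numeral)
    then show ?thesis by (simp add: iso)
  qed
  have "(norm (V n ?h - ?h))\<^sup>2 = 4 * ((norm ?h)\<^sup>2 - (norm ?h')\<^sup>2)"
    using parallelogram_law[of ?h "V n ?h"]
    by (simp add: iso norm_minus_commute power_mult_distrib power2_eq_square)
  moreover have "(\<Sum>i<n. (norm (V i ?h' - ?h'))\<^sup>2) \<le> (\<Sum>i<n. (norm (V i ?h - ?h))\<^sup>2)"
    by (intro sum_mono power_mono move norm_ge_zero)
  moreover have "(norm (V n ?h' - ?h'))\<^sup>2 \<le> (norm (V n ?h - ?h))\<^sup>2"
    by (intro power_mono move norm_ge_zero)
  ultimately show ?case using Suc by simp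
qed simp

lemma norm_funpow_displacement:
  fixes V :: "'h \<Rightarrow> 'h::complex_hilbert_space"
  assumes "linear V" "\<And>x. norm (V x) = norm x"
  shows "norm ((V ^^ k) x - x) \<le> real k * norm (V x - x)"
proof (induction k)
  case (Suc k)
  have "norm ((V ^^ Suc k) x - x) \<le> norm (V ((V ^^ k) x) - V x) + norm (V x - x)"
    using norm_triangle_ineq[of "V ((V ^^ k) x) - V x" "V x - x"] by simp
  also have "norm (V ((V ^^ k) x) - V x) = norm ((V ^^ k) x - x)"
    using assms by (metis linear_diff)
  finally show ?case using Suc by (simp add: algebra_simps)
qed simp

lemma norm_funpow_isometry:
  fixes V :: "'a::real_normed_vector \<Rightarrow> 'a"
  assumes "\<And>x. norm (V x) = norm x"
  shows "norm ((V ^^ k) x) = norm x"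
  by (induction k) (use assms in auto)

lemma linear_funpow:
  fixes V :: "'a::real_vector \<Rightarrow> 'a"
  shows "linear V \<Longrightarrow> linear (V ^^ k)"
  by (induction k) (simp_all add: linear_iff)

text \<open>
  The vectors \<open>h x\<close> obtained from \<open>x\<close> by the averages lie in the convex hull of the cube orbit,
  hence within \<open>d\<close> of \<open>x\<close>, and so have lost little norm. The total squared displacement of the \<open>h x\<close>
  is therefore at most \<open>8 * d * (\<Sum>x\<in>F. norm x)\<close>, and some index carries at most an \<open>n\<close>-th
  part of it. A power \<open>k i\<close> of order \<open>\<surd>n\<close> makes up for that factor; the summand
  \<open>2 * d\<close> is the cost of replacing \<open>x\<close> by \<open>h x\<close>. Summing over \<open>F\<close> before choosing the index
  makes one index serve all vectors of \<open>F\<close>.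
\<close>

lemma exists_slow_direction:
  fixes V :: "nat \<Rightarrow> 'h \<Rightarrow> 'h::complex_hilbert_space"
  assumes lin: "\<And>i. linear (V i)" and iso: "\<And>i x. norm (V i x) = norm x"
    and comm: "\<And>i j x. V i (V j x) = V j (V i x)"
    and F: "finite F" and n: "n > 0" and d: "d \<ge> 0"
    and cube: "\<And>x. x \<in> F \<Longrightarrow> cube_orbit V n x \<subseteq> cball x d"
    and k: "\<And>i. i < n \<Longrightarrow> (k i)\<^sup>2 \<le> 2 * n"
  shows "\<exists>i<n. \<forall>x\<in>F. norm ((V i ^^ k i) x - x) \<le> 2 * d + 4 * sqrt (d * (\<Sum>x\<in>F. norm x))"
proof -
  define h where "h x = half_step_product V n x" for x
  define R where "R = (\<Sum>x\<in>F. norm x)"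
  have near: "norm (x - h x) \<le> d" if "x \<in> F" for x
  proof -
    have "convex hull (cube_orbit V n x) \<subseteq> cball x d"
      using cube[OF that] by (simp add: hull_minimal)
    then show ?thesis
      using half_step_product_in_convex_hull[of V n x] lin by (auto simp: h_def dist_norm)
  qed
  have loss: "(norm x)\<^sup>2 - (norm (h x))\<^sup>2 \<le> 2 * (d * norm x)" if "x \<in> F" for x
  proof -
    have "norm x - norm (h x) \<le> d"
      using near[OF that] norm_triangle_ineq2[of x "h x"] by linarith
    then have "2 * norm x * (norm x - norm (h x)) \<le> 2 * norm x * d"
      by (intro mult_left_mono) auto
    \<comment> \<open>\<open>r\<^sup>2 - s\<^sup>2 \<le> 2 r (r - s)\<close> for all real \<open>r\<close>, \<open>s\<close>, since \<open>0 \<le> (r - s)\<^sup>2\<close>.\<close>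
    moreover have "0 \<le> (norm x - norm (h x))\<^sup>2" by simp
    ultimately show ?thesis by (simp add: power2_eq_square algebra_simps)
  qed
  have "(\<Sum>i<n. \<Sum>x\<in>F. (norm (V i (h x) - h x))\<^sup>2) = (\<Sum>x\<in>F. \<Sum>i<n. (norm (V i (h x) - h x))\<^sup>2)"
    by (rule sum.swap)
  also have "\<dots> \<le> (\<Sum>x\<in>F. 8 * (d * norm x))"
  proof (rule sum_mono)
    fix x assume "x \<in> F"
    have "(\<Sum>i<n. (norm (V i (h x) - h x))\<^sup>2) \<le> 4 * ((norm x)\<^sup>2 - (norm (h x))\<^sup>2)"
      unfolding h_def by (rule sum_displacements_half_step_product[OF lin iso comm])
    also have "\<dots> \<le> 8 * (d * norm x)"
      using loss[OF \<open>x \<in> F\<close>] by simp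
    finally show "(\<Sum>i<n. (norm (V i (h x) - h x))\<^sup>2) \<le> 8 * (d * norm x)" .
  qed
  also have "\<dots> = 8 * d * R"
    by (simp add: R_def sum_distrib_left mult.assoc)
  also have "\<dots> = (\<Sum>i<n. 8 * d * R / n)"
    using n by simp
  finally obtain i where i: "i < n" "(\<Sum>x\<in>F. (norm (V i (h x) - h x))\<^sup>2) \<le> 8 * d * R / n"
    using sum_strict_mono[of "{..<n}" "\<lambda>_. 8 * d * R / n"
        "\<lambda>i. \<Sum>x\<in>F. (norm (V i (h x) - h x))\<^sup>2"] n
    by (metis (no_types, lifting) empty_iff finite_lessThan lessThan_iff not_le)
  have "norm ((V i ^^ k i) x - x) \<le> 2 * d + 4 * sqrt (d * R)" if "x \<in> F" for x
  proof -
    let ?W = "V i ^^ k i"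
    have "(norm (V i (h x) - h x))\<^sup>2 \<le> 8 * d * R / n"
      using member_le_sum[of x F "\<lambda>x. (norm (V i (h x) - h x))\<^sup>2"] i(2) F that by auto
    moreover have "(real (k i))\<^sup>2 \<le> 2 * real n"
      using k[OF i(1)] by (metis of_nat_le_iff of_nat_mult of_nat_numeral of_nat_power)
    ultimately have "(real (k i) * norm (V i (h x) - h x))\<^sup>2 \<le> (2 * real n) * (8 * d * R / n)"
      unfolding power_mult_distrib by (intro mult_mono) auto
    also have "\<dots> = (4 * sqrt (d * R))\<^sup>2"
      using n d by (simp add: power_mult_distrib R_def sum_nonneg)
    finally have "real (k i) * norm (V i (h x) - h x) \<le> 4 * sqrt (d * R)"
      by (rule power2_le_imp_le) (use d in \<open>simp add: R_def sum_nonneg\<close>)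
    then have "norm (?W (h x) - h x) \<le> 4 * sqrt (d * R)"
      using norm_funpow_displacement[of "V i" "k i" "h x", OF lin iso] by linarith
    moreover have "norm (?W x - ?W (h x)) \<le> d"
      unfolding linear_diff[OF linear_funpow[OF lin], symmetric]
        norm_funpow_isometry[of "V i", OF iso] by (rule near[OF that])
    moreover have "norm (h x - x) \<le> d"
      using near[OF that] by (simp add: norm_minus_commute)
    ultimately have "norm ((?W x - ?W (h x)) + (?W (h x) - h x) + (h x - x))
        \<le> d + 4 * sqrt (d * R) + d"
      by (intro order_trans[OF norm_triangle_ineq] add_mono) auto
    then show ?thesis by simp
  qed
  then show ?thesis using i(1) by (auto simp: R_def)
qed

section \<open>Compact subsets of \<open>\<ell>\<^sub>1\<close>\<close>

lemma abs_pairing_le: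
  assumes "x \<in> ell1" "\<And>n. \<bar>z n\<bar> \<le> 1" "\<And>n. n \<in> A \<Longrightarrow> z n = 0"
  shows "\<bar>pairing x z\<bar> \<le> (\<Sum>\<^sub>\<infinity>n\<in>- A. \<bar>x n\<bar>)"
proof -
  have s: "(\<lambda>n. \<bar>x n\<bar>) summable_on B" for B
    using assms(1) summable_on_subset_banach unfolding ell1_def by blast
  have le: "norm (x n * z n) \<le> \<bar>x n\<bar>" for n
    using assms(2)[of n] by (simp add: abs_mult mult_left_le)
  have "pairing x z = (\<Sum>\<^sub>\<infinity>n\<in>- A. x n * z n)"
    unfolding pairing_def using assms(3) by (intro infsum_cong_neutral) auto
  also have "norm \<dots> \<le> (\<Sum>\<^sub>\<infinity>n\<in>- A. \<bar>x n\<bar>)"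
    by (intro norm_infsum_le[OF has_sum_infsum has_sum_infsum] s le
        abs_summable_summable[OF summable_on_comparison_test[OF s]]) (use le in auto)
  finally show ?thesis by simp
qed

lemma ell1_tail_small:
  assumes "x \<in> ell1" "e > 0"
  shows "\<exists>N. \<forall>M\<ge>N. (\<Sum>\<^sub>\<infinity>n\<in>- {..<M}. \<bar>x n\<bar>) < e"
proof -
  have s: "(\<lambda>n. \<bar>x n\<bar>) summable_on B" for B
    using assms(1) summable_on_subset_banach unfolding ell1_def by blast
  have "(\<lambda>M. \<Sum>n<M. \<bar>x n\<bar>) \<longlonglongrightarrow> (\<Sum>\<^sub>\<infinity>n. \<bar>x n\<bar>)"
    using has_sum_imp_sums[OF has_sum_infsum[OF s[of UNIV]]] by (simp add: sums_def)
  then obtain N where "\<forall>M\<ge>N. \<bar>(\<Sum>n<M. \<bar>x n\<bar>) - (\<Sum>\<^sub>\<infinity>n. \<bar>x n\<bar>)\<bar> < e"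
    using assms(2) by (auto simp: LIMSEQ_iff)
  moreover have "(\<Sum>\<^sub>\<infinity>n\<in>- {..<M}. \<bar>x n\<bar>) = (\<Sum>\<^sub>\<infinity>n. \<bar>x n\<bar>) - (\<Sum>n<M. \<bar>x n\<bar>)" for M
    using infsum_Diff[OF s s, of "{..<M}" UNIV] by (simp add: Compl_eq_Diff_UNIV)
  ultimately show ?thesis by (smt (verit))
qed

text \<open>
  A compact set is within \<open>e / 2\<close> of a finite set, and finitely many summable sequences have a common
  index beyond which their tails are below \<open>e / 2\<close>.
\<close>

lemma compact_pairing_tail_small:
  assumes "compactin ell1.mtopology K" "e > 0"
  obtains N where "\<And>x z. x \<in> K \<Longrightarrow> (\<And>n. \<bar>z n\<bar> \<le> 1) \<Longrightarrow> (\<And>n. n < N \<Longrightarrow> z n = 0) \<Longrightarrow>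
    \<bar>pairing x z\<bar> < e"
proof -
  have K: "K \<subseteq> ell1"
    using assms(1) compactin_subset_topspace by fastforce
  obtain C where C: "finite C" "C \<subseteq> K" "K \<subseteq> (\<Union>c\<in>C. ell1.mball c (e / 2))"
    using ell1.compactin_imp_mtotally_bounded[OF assms(1)] assms(2)
    unfolding ell1.mtotally_bounded_def by (metis half_gt_zero)
  have "\<forall>c\<in>C. \<exists>N. \<forall>M\<ge>N. (\<Sum>\<^sub>\<infinity>n\<in>- {..<M}. \<bar>c n\<bar>) < e / 2"
    using ell1_tail_small C(2) K assms(2) by (meson half_gt_zero subsetD)
  then obtain N0 where N0: "\<And>c M. c \<in> C \<Longrightarrow> M \<ge> N0 c \<Longrightarrow> (\<Sum>\<^sub>\<infinity>n\<in>- {..<M}. \<bar>c n\<bar>) < e / 2"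
    by metis
  define N where "N = Max (insert 0 (N0 ` C))"
  have N: "N0 c \<le> N" if "c \<in> C" for c
    unfolding N_def using C(1) that by (intro Max_ge) auto
  show ?thesis
  proof
    fix x z assume x: "x \<in> K" and z: "\<And>n. \<bar>z n :: real\<bar> \<le> 1" "\<And>n. n < N \<Longrightarrow> z n = 0"
    obtain c where c: "c \<in> C" "ell1_dist c x < e / 2"
      using C(3) x by (auto simp: ell1.in_mball)
    have l: "x \<in> ell1" "c \<in> ell1" using x c C K by auto
    have zl: "z \<in> ell_infty" using z(1) by (auto simp: ell_infty_def bounded_iff)
    have dl: "(\<lambda>n. c n - x n) \<in> ell1"
      using summable_ell1_diff[OF l(2,1)] by (simp add: ell1_def)
    have "pairing (\<lambda>n. c n - x n) z = pairing c z - pairing x z"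
      using infsum_add[OF summable_pairing[OF dl zl] summable_pairing[OF l(1) zl]]
      by (simp add: pairing_def left_diff_distrib)
    moreover have "\<bar>pairing (\<lambda>n. c n - x n) z\<bar> \<le> ell1_dist c x"
      using abs_pairing_le[OF dl z(1), of "{}"] by (simp add: ell1_dist_def)
    moreover have "\<bar>pairing c z\<bar> \<le> (\<Sum>\<^sub>\<infinity>n\<in>- {..<N}. \<bar>c n\<bar>)"
      using abs_pairing_le[OF l(2) z(1), of "{..<N}"] z(2) by simp
    ultimately show "\<bar>pairing x z\<bar> < e"
      using N0[OF c(1) N[OF c(1)]] c(2) by linarith
  qed
qed

lemma pairing_single: "pairing (\<lambda>m. if m = n then s else 0) z = s * z n"
proof -
  have "pairing (\<lambda>m. if m = n then s else 0) z = (\<Sum>\<^sub>\<infinity>m\<in>{n}. s * z m)"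
    unfolding pairing_def by (intro infsum_cong_neutral) auto
  then show ?thesis by simp
qed

text \<open>
  The sequences \<open>e\<^sub>n / a\<^sub>n\<close> have norm \<open>1 / a\<^sub>n\<close> and so converge to \<open>0\<close>. Finitely many \<open>a n\<close> may
  vanish, in which case the quotient is the zero sequence.
\<close>

lemma compactin_weighted_basis:
  assumes "filterlim a at_top sequentially"
  shows "compactin ell1.mtopology
    (insert (\<lambda>_. 0) (range (\<lambda>n m. if m = n then 1 / real (a n) else 0)))"
proof (rule compactin_sequence_with_limit)
  let ?x = "\<lambda>n m. if m = n then 1 / real (a n) else 0"
  have abs_single: "\<bar>?x n m\<bar> = ?x n m" for n m by simp
  have hs: "((\<lambda>m. \<bar>?x n m\<bar>) has_sum 1 / real (a n)) UNIV" for n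
  proof -
    have "(?x n has_sum sum (?x n) {n}) {n}" by (rule has_sum_finite) simp
    then show ?thesis
      unfolding abs_single
      by (subst has_sum_cong_neutral[where T = "{n}" and g = "?x n"]) auto
  qed
  have x: "?x n \<in> ell1" for n
    using hs has_sum_imp_summable by (auto simp: ell1_def)
  have dist: "ell1_dist (?x n) (\<lambda>_. 0) = 1 / real (a n)" for n
    using infsumI[OF hs[of n]] by (simp add: ell1_dist_def)
  show "range ?x \<subseteq> topspace ell1.mtopology" using x by auto
  show "limitin ell1.mtopology ?x (\<lambda>_. 0) sequentially"
    unfolding ell1.limit_metric_sequentially
  proof (intro conjI allI impI)
    show "(\<lambda>_. 0) \<in> ell1" by (simp add: ell1_def)
    fix e :: real assume "e > 0"
    have "filterlim (\<lambda>n. real (a n)) at_top sequentially"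
      using filterlim_compose[OF filterlim_real_sequentially assms] .
    then have "eventually (\<lambda>n. real (a n) > 1 / e) sequentially"
      by (simp add: filterlim_at_top_dense)
    then obtain N where N: "\<And>n. n \<ge> N \<Longrightarrow> real (a n) > 1 / e"
      by (auto simp: eventually_sequentially)
    have "1 / real (a n) < e" if "n \<ge> N" for n
    proof -
      have "0 < real (a n)"
        using N[OF that] \<open>e > 0\<close> by (meson less_trans zero_less_divide_1_iff)
      then show ?thesis using N[OF that] \<open>e > 0\<close> by (simp add: field_simps)
    qed
    then show "\<exists>N. \<forall>n\<ge>N. ?x n \<in> ell1 \<and> ell1_dist (?x n) (\<lambda>_. 0) < e"
      using x dist by auto
  qed
qed auto

lemma filterlim_floor_sqrt: "filterlim floor_sqrt at_top sequentially"
  unfolding filterlim_at_top eventually_sequentially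
  by (meson le_floor_sqrt_iff)

section \<open>Neighbourhoods of the identity\<close>

text \<open>
  A basic open set of the product topology restricts only finitely many coordinates. Here a coordinate
  is a vector \<open>x\<close>, and the restriction on \<open>U x\<close> is implied by a norm bound because \<open>id x = x\<close>.
\<close>

lemma strong_operator_nbhd_id:
  fixes S :: "('h::complex_hilbert_space \<Rightarrow> 'h) set"
  assumes "openin (subtopology strong_operator_topology S) W" "id \<in> W"
    and "S \<subseteq> unitary_operators"
  obtains F e where "finite F" "e > 0"
    "\<And>U. U \<in> S \<Longrightarrow> (\<And>x. x \<in> F \<Longrightarrow> norm (U x - x) < e) \<Longrightarrow> U \<in> W"
proof -
  have "subtopology strong_operator_topology S = subtopology (product_topology (\<lambda>_. euclidean) UNIV) S"
    unfolding strong_operator_topology_def subtopology_subtopology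
    using assms(3) by (simp add: Int_absorb1)
  then obtain T where T: "openin (product_topology (\<lambda>_::'h. euclidean) UNIV) T" "W = T \<inter> S"
    using assms(1) by (auto simp: openin_subtopology)
  then obtain B where B: "finite {i. B i \<noteq> UNIV}" "\<And>i. open (B i)" "id \<in> Pi\<^sub>E UNIV B"
      "Pi\<^sub>E UNIV B \<subseteq> T"
    using assms(2) unfolding openin_product_topology_alt by force
  let ?F = "{i. B i \<noteq> UNIV}"
  have "\<exists>d>0. ball x d \<subseteq> B x" for x
  proof -
    have "x \<in> B x" using B(3) by (auto simp: PiE_iff)
    then show ?thesis using B(2)[of x] by (simp add: open_contains_ball)
  qed
  then obtain d where d: "\<And>x. d x > (0::real)" "\<And>x. ball x (d x) \<subseteq> B x" by metis
  define e where "e = Min (insert 1 (d ` ?F))"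
  have "e > 0" using B(1) d(1) by (auto simp: e_def)
  have e: "e \<le> d x" if "x \<in> ?F" for x
    using B(1) that by (auto simp: e_def)
  show ?thesis
  proof (rule that[OF B(1) \<open>e > 0\<close>])
    fix U assume U: "U \<in> S" "\<And>x. x \<in> ?F \<Longrightarrow> norm (U x - x) < e"
    have "U x \<in> B x" for x
    proof (cases "x \<in> ?F")
      case True
      have "norm (U x - x) < d x" using U(2)[OF True] e[OF True] by linarith
      then have "U x \<in> ball x (d x)" by (simp add: dist_norm norm_minus_commute)
      then show ?thesis using d(2) by blast
    qed auto
    then show "U \<in> W" using B(4) T(2) U(1) by (auto simp: PiE_iff)
  qed
qed

lemma openin_strong_operator_preimage:
  assumes "continuous_map X (subtopology strong_operator_topology S) f" "finite F"
  shows "openin X {y \<in> topspace X. \<forall>x\<in>F. norm (f y x - x) < d}"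
proof -
  have "continuous_map X (product_topology (\<lambda>_. euclidean) UNIV) f"
    using assms(1) by (simp add: strong_operator_topology_def continuous_map_in_subtopology)
  then have "continuous_map X euclidean (\<lambda>y. f y x)" for x
    by (simp add: continuous_map_componentwise_UNIV)
  then have "openin X {y \<in> topspace X. f y x \<in> ball x d}" for x
    by (rule openin_continuous_map_preimage) simp
  then have "openin X ((\<Inter>x\<in>F. {y \<in> topspace X. f y x \<in> ball x d}) \<inter> topspace X)"
    using assms(2) by (intro openin_INT) auto
  moreover have "(\<Inter>x\<in>F. {y \<in> topspace X. f y x \<in> ball x d}) \<inter> topspace X
      = {y \<in> topspace X. \<forall>x\<in>F. norm (f y x - x) < d}"
    by (auto simp: dist_norm norm_minus_commute)
  ultimately show ?thesis by simp
qed

section \<open>The dual group of \<open>\<ell>\<^sub>1\<close>\<close>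

theorem corollary4p4:
  shows "\<not> unitarily_representable_on TYPE('h::complex_hilbert_space) ell_infty_group tau_k"
proof
  assume "unitarily_representable_on TYPE('h) ell_infty_group tau_k"
  then obtain S :: "('h \<Rightarrow> 'h) set" and f where S: "subgroup S unitary_group"
    and iso: "f \<in> iso ell_infty_group (unitary_group\<lparr>carrier := S\<rparr>)"
    and homeo: "homeomorphic_map tau_k (subtopology strong_operator_topology S) f"
    by (auto simp: unitarily_representable_on_def topological_group_iso_def)
  have SU: "S \<subseteq> unitary_operators"
    using subgroup.subset[OF S] by (simp add: unitary_group_def)
  have fS: "f y \<in> S" if "y \<in> ell_infty" for y
    using iso that by (auto simp: iso_def hom_def ell_infty_group_def)
  have f_add: "f (\<lambda>n. y n + z n) = f y \<circ> f z" if "y \<in> ell_infty" "z \<in> ell_infty" for y z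
    using iso that by (auto simp: iso_def hom_def ell_infty_group_def unitary_group_def)
  have f_inj: "inj_on f ell_infty"
    using iso by (auto simp: iso_def bij_betw_def ell_infty_group_def)
  have unitary: "f y \<in> unitary_operators" if "y \<in> ell_infty" for y
    using fS[OF that] SU by blast
  have zero: "(\<lambda>_. 0) \<in> ell_infty" by (simp add: ell_infty_def)
  have f_zero: "f (\<lambda>_. 0) = id"
  proof -
    have "f (\<lambda>_. 0) (f (\<lambda>_. 0) x) = f (\<lambda>_. 0) x" for x
      using f_add[OF zero zero] by (simp add: fun_eq_iff)
    then show ?thesis
      using unitary_operators_inj[OF unitary[OF zero]] by (auto simp: inj_def fun_eq_iff)
  qed

  \<comment> \<open>Growth of order \<open>\<surd>n\<close> is as fast as \<open>exists_slow_direction\<close> permits, and any growth to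
    infinity makes \<open>K\<close> compact.\<close>
  define a where "a = floor_sqrt"
  define K where "K = insert (\<lambda>_. 0) (range (\<lambda>n m. if m = n then 1 / real (a n) else 0))"
  have "compactin ell1.mtopology K"
    unfolding K_def a_def by (intro compactin_weighted_basis filterlim_floor_sqrt)
  then obtain W where W: "openin tau_k W" "(\<lambda>_. 0) \<in> W" "W \<subseteq> tau_k_nbhd (\<lambda>_. 0) K 1"
    using tau_k_nbhd_interior[OF _ zero, of K 1] by auto
  have "openin (subtopology strong_operator_topology S) (f ` W)"
    using homeo W(1) by (meson homeomorphic_imp_open_map open_map_def)
  moreover have "id \<in> f ` W" using W(2) f_zero by force
  ultimately obtain F e where F: "finite F" "e > 0"
      and FW: "\<And>U. U \<in> S \<Longrightarrow> (\<And>x. x \<in> F \<Longrightarrow> norm (U x - x) < e) \<Longrightarrow> U \<in> f ` W"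
    using strong_operator_nbhd_id[OF _ _ SU] by metis
  have W_ell: "W \<subseteq> ell_infty" using W(3) by (auto simp: tau_k_nbhd_def)

  define R where "R = (\<Sum>x\<in>F. norm x)"
  have "((\<lambda>d. 2 * d + 4 * sqrt (d * R)) \<longlongrightarrow> 2 * 0 + 4 * sqrt (0 * R)) (at_right 0)"
    by (intro tendsto_intros)
  then have "eventually (\<lambda>d. 2 * d + 4 * sqrt (d * R) < e) (at_right 0)"
    using F(2) by (auto intro: order_tendstoD)
  then have "eventually (\<lambda>d. d > 0 \<and> 2 * d + 4 * sqrt (d * R) < e) (at_right 0)"
    using eventually_at_right_less by (rule eventually_elim2) auto
  then obtain d where d: "d > 0" "2 * d + 4 * sqrt (d * R) < e"
    using eventually_happens'[OF trivial_limit_at_right_real] by blast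

  have "openin tau_k {y \<in> topspace tau_k. \<forall>x\<in>F. norm (f y x - x) < d}"
    by (rule openin_strong_operator_preimage[OF homeomorphic_imp_continuous_map[OF homeo] F(1)])
  then have "tau_k_open {y \<in> ell_infty. \<forall>x\<in>F. norm (f y x - x) < d}"
    by (simp add: openin_tau_k topspace_tau_k)
  moreover have "(\<lambda>_. 0) \<in> {y \<in> ell_infty. \<forall>x\<in>F. norm (f y x - x) < d}"
    using zero f_zero d by simp
  ultimately obtain L r where L: "compactin ell1.mtopology L" "r > 0"
      "tau_k_nbhd (\<lambda>_. 0) L r \<subseteq> {y \<in> ell_infty. \<forall>x\<in>F. norm (f y x - x) < d}"
    unfolding tau_k_open_def by blast
  obtain N0 where N0: "\<And>x z. x \<in> L \<Longrightarrow> (\<And>n. \<bar>z n\<bar> \<le> 1) \<Longrightarrow> (\<And>n. n < N0 \<Longrightarrow> z n = 0) \<Longrightarrow>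
      \<bar>pairing x z\<bar> < r"
    using compact_pairing_tail_small[OF L(1,2)] by blast
  \<comment> \<open>The successor makes \<open>N\<close> positive, so that the block \<open>{N..<2N}\<close> is nonempty and \<open>a n > 0\<close> on it.\<close>
  define N where "N = Suc N0"
  define V where "V i = f (\<lambda>n. of_bool (n = N + i))" for i
  have bin: "(\<lambda>n. of_bool (P n)) \<in> ell_infty" for P
    by (auto simp: ell_infty_def bounded_iff intro!: exI[of _ 1])
  have f_small: "norm (f (\<lambda>n. of_bool (n \<in> A)) x - x) < d" if "A \<subseteq> {N..}" "x \<in> F" for A x
  proof -
    have "(\<lambda>n. of_bool (n \<in> A)) \<in> tau_k_nbhd (\<lambda>_. 0) L r"
      using N0[of _ "\<lambda>n. of_bool (n \<in> A)"] that(1) bin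
      by (force simp: tau_k_nbhd_def N_def pairing_def[of _ "\<lambda>_. 0"])
    then show ?thesis using L(3) that(2) by blast
  qed
  \<comment> \<open>Adding \<open>e\<^bsub>N+n\<^esub>\<close> to the indicator sequence of a subset of \<open>{N..<N + n}\<close> again gives an
    indicator sequence, so the products of distinct \<open>V i\<close> are images of indicator sequences.\<close>
  have orbit: "\<exists>A\<subseteq>{N..<N + n}. v = f (\<lambda>n. of_bool (n \<in> A)) x"
    if "v \<in> cube_orbit V n x" for n v x
    using that
  proof (induction n arbitrary: v)
    case 0
    then show ?case using f_zero by (intro exI[of _ "{}"]) auto
  next
    case (Suc n)
    from Suc.prems consider "v \<in> cube_orbit V n x" | u where "u \<in> cube_orbit V n x" "v = V n u"
      by auto
    then show ?case
    proof cases
      case 1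
      then obtain A where "A \<subseteq> {N..<N + n}" "v = f (\<lambda>n. of_bool (n \<in> A)) x"
        using Suc.IH by blast
      then show ?thesis by (intro exI[of _ A]) auto
    next
      case 2
      then obtain A where A: "A \<subseteq> {N..<N + n}" "u = f (\<lambda>n. of_bool (n \<in> A)) x"
        using Suc.IH by blast
      have "(\<lambda>m. of_bool (m \<in> insert (N + n) A)) =
          (\<lambda>m. of_bool (m = N + n) + of_bool (m \<in> A) :: real)"
        using A(1) by (auto simp: fun_eq_iff)
      then have "v = f (\<lambda>m. of_bool (m \<in> insert (N + n) A)) x"
        using f_add[OF bin bin, of "\<lambda>m. m = N + n" "\<lambda>m. m \<in> A"] A(2) 2(2) by (simp add: V_def)
      then show ?thesis using A(1) by (intro exI[of _ "insert (N + n) A"]) auto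
    qed
  qed
  have "\<exists>i<N. \<forall>x\<in>F. norm ((V i ^^ a (N + i)) x - x) \<le> 2 * d + 4 * sqrt (d * (\<Sum>x\<in>F. norm x))"
  proof (rule exists_slow_direction[where n = N])
    have Vu: "V i \<in> unitary_operators" for i
      using unitary[OF bin] by (simp add: V_def)
    show "linear (V i)" for i
      using Vu[of i] by (intro linearI) (auto simp: unitary_operators_def scaleR_scaleC)
    show "norm (V i x) = norm x" for i x
      using Vu[of i] by (simp add: unitary_operators_def norm_eq_sqrt_cinner)
    show "V i (V j x) = V j (V i x)" for i j x
      using f_add[OF bin bin, of "\<lambda>n. n = N + i" "\<lambda>n. n = N + j"]
        f_add[OF bin bin, of "\<lambda>n. n = N + j" "\<lambda>n. n = N + i"]
      by (simp add: V_def add.commute fun_eq_iff)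
    show "cube_orbit V N x \<subseteq> cball x d" if x: "x \<in> F" for x
    proof
      fix v assume "v \<in> cube_orbit V N x"
      then obtain A where "A \<subseteq> {N..<N + N}" "v = f (\<lambda>n. of_bool (n \<in> A)) x"
        using orbit by blast
      then show "v \<in> cball x d"
        using f_small[of A x] x by (force simp: dist_norm norm_minus_commute)
    qed
    show "(a (N + i))\<^sup>2 \<le> 2 * N" if "i < N" for i
      using floor_sqrt_power2_le[of "N + i"] that unfolding a_def by linarith
  qed (use F d in \<open>auto simp: N_def\<close>)
  then obtain i where i: "\<And>x. x \<in> F \<Longrightarrow> norm ((V i ^^ a (N + i)) x - x) < e"
    using d(2) unfolding R_def by (meson le_less_trans)
  have V_pow: "V i ^^ k = f (\<lambda>n. real k * of_bool (n = N + i))" for k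
  proof (induction k)
    case 0
    then show ?case by (simp add: f_zero id_def)
  next
    case (Suc k)
    have "(\<lambda>n. real k * of_bool (n = N + i)) \<in> ell_infty"
      by (auto simp: ell_infty_def bounded_iff intro!: exI[of _ "real k"])
    then have "f (\<lambda>n. of_bool (n = N + i) + real k * of_bool (n = N + i)) = V i \<circ> V i ^^ k"
      unfolding Suc unfolding V_def by (rule f_add[OF bin])
    then show ?case by (simp add: algebra_simps)
  qed
  \<comment> \<open>The sequence \<open>a\<^sub>m e\<^sub>m\<close> with \<open>m = N + i\<close> acts as a power of \<open>V i\<close>, hence almost trivially on \<open>F\<close>,
    but it pairs to \<open>1\<close> with the member \<open>e\<^sub>m / a\<^sub>m\<close> of \<open>K\<close>.\<close>
  define y where "y = (\<lambda>n. real (a (N + i)) * of_bool (n = N + i))"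
  have y: "y \<in> ell_infty"
    by (auto simp: y_def ell_infty_def bounded_iff intro!: exI[of _ "real (a (N + i))"])
  have "f y \<in> f ` W"
    using i FW[OF fS[OF y]] V_pow[of "a (N + i)"] by (simp add: y_def)
  then have "y \<in> W"
    using f_inj y W_ell by (auto simp: inj_on_image_mem_iff)
  then have "\<bar>pairing (\<lambda>m. if m = N + i then 1 / real (a (N + i)) else 0) y\<bar> < 1"
    using W(3) by (auto simp: tau_k_nbhd_def K_def pairing_def[of _ "\<lambda>_. 0"])
  moreover have "a (N + i) > 0"
    by (simp add: a_def N_def)
  ultimately show False
    by (simp add: pairing_single y_def)
qed

end
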